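(* The calculus $\mathsf{LNS}_\mathsf{KB}$ is sound and complete for modal logic $\mathsf{KB}$: for every mono-modal formula $\varphi$, the sequent $\epsilon\Rightarrow\varphi$ is derivable in $\mathsf{LNS}_\mathsf{KB}$ if and only if $\varphi\in\mathsf{KB}$.
   Context: Mono-modal formulas: $A ::= p \mid \bot \mid A\to A \mid \Box A$ ($p$ from a set of atoms), with $\neg,\wedge,\vee,\Diamond$ defined classically ($\Diamond A:=\neg\Box\neg A$). $\mathsf{KB}$ is the set of formulas true at every world of every Kripke model $\langle W,R,V\rangle$ whose relation $R$ is symmetric, where $w\Vdash\Box A$ iff $v\Vdash A$ for all $v$ with $wRv$. A component is $\Gamma\Rightarrow\Delta$ with $\Gamma,\Delta$ finite multisets of formulas; $\epsilon$ denotes an empty multiset. Linear nested sequents for $\mathsf{KB}$: $S ::= \Gamma\Rightarrow\Delta \mid \Gamma\Rightarrow\Delta\nearrow S$. $\mathcal{G}$ denotes a possibly empty prefix, and $\mathcal{G}\nearrow X$ is $X$ if $\mathcal{G}$ is empty. Derivations are finite trees of rule instances whose leaves are instances of $(id)$ or $\bot_L$. Rules of $\mathsf{LNS}_\mathsf{KB}$ (premisses ⟹ conclusion): $(id)$: ⟹ $\mathcal{G}\nearrow\Gamma,p\Rightarrow p,\Delta$ ($p$ atomic). $\bot_L$: ⟹ $\mathcal{G}\nearrow\Gamma,\bot\Rightarrow\Delta$. $\mathsf{EW}$: $\mathcal{G}$ ⟹ $\mathcal{G}\nearrow\Gamma\Rightarrow\Delta$ ($\mathcal{G}$ nonempty).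 $\to_R$: $\mathcal{G}\nearrow\Gamma,A\Rightarrow\Delta,A\to B,B$ ⟹ $\mathcal{G}\nearrow\Gamma\Rightarrow\Delta,A\to B$. $\to_L$: $\mathcal{G}\nearrow\Gamma,A\to B,B\Rightarrow\Delta$ and $\mathcal{G}\nearrow\Gamma,A\to B\Rightarrow\Delta,A$ ⟹ $\mathcal{G}\nearrow\Gamma,A\to B\Rightarrow\Delta$. $\Box_R$: $\mathcal{G}\nearrow\Gamma\Rightarrow\Delta,\Box A\nearrow\epsilon\Rightarrow A$ ⟹ $\mathcal{G}\nearrow\Gamma\Rightarrow\Delta,\Box A$. $\Box_L^1$: $\mathcal{G}\nearrow\Gamma,\Box A\Rightarrow\Delta\nearrow\Sigma,A\Rightarrow\Pi$ ⟹ $\mathcal{G}\nearrow\Gamma,\Box A\Rightarrow\Delta\nearrow\Sigma\Rightarrow\Pi$. $\Box_L^2$: $\mathcal{G}\nearrow\Gamma,A\Rightarrow\Delta$ ⟹ $\mathcal{G}\nearrow\Gamma\Rightarrow\Delta\nearrow\Sigma,\Box A\Rightarrow\Pi$. *)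

theory Defs
  imports Main "HOL-Library.Multiset"
begin

datatype 'p fm =
    Atom 'p
  | Bot ("\<^bold>\<bottom>")
  | Imp "'p fm" "'p fm" (infixr "\<^bold>\<rightarrow>" 55)
  | Box "'p fm" ("\<^bold>\<box> _" [70] 70)

definition kripke_model :: "'w set \<Rightarrow> ('w \<times> 'w) set \<Rightarrow> ('p \<Rightarrow> 'w set) \<Rightarrow> bool" where
  "kripke_model W R V \<longleftrightarrow> W \<noteq> {} \<and> R \<subseteq> W \<times> W \<and> (\<forall>p. V p \<subseteq> W)"

text \<open>In a model \<open>R \<subseteq> W \<times> W\<close>, so the clause for \<open>Box\<close> only ever visits worlds in \<open>W\<close>,
  and \<open>forces\<close> need not mention \<open>W\<close>.\<close>

primrec forces :: "('w \<times> 'w) set \<Rightarrow> ('p \<Rightarrow> 'w set) \<Rightarrow> 'w \<Rightarrow> 'p fm \<Rightarrow> bool" where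
  "forces R V w (Atom p) \<longleftrightarrow> w \<in> V p"
| "forces R V w \<^bold>\<bottom> \<longleftrightarrow> False"
| "forces R V w (A \<^bold>\<rightarrow> B) \<longleftrightarrow> (forces R V w A \<longrightarrow> forces R V w B)"
| "forces R V w (\<^bold>\<box> A) \<longleftrightarrow> (\<forall>v. (w, v) \<in> R \<longrightarrow> forces R V v A)"

text \<open>HOL cannot quantify over the type of worlds inside a definition, so \<open>KB\<close> carries that type
  as a parameter. The carrier \<open>W\<close> ranges over all nonempty subsets of the type, so models of every
  smaller cardinality are included as well.\<close>

definition KB :: "'w itself \<Rightarrow> 'p fm set" where
  "KB (_ :: 'w itself) =
     {A. \<forall>(W :: 'w set) R V. kripke_model W R V \<and> sym R \<longrightarrow> (\<forall>w\<in>W. forces R V w A)}"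

datatype 'p component = Component "'p fm multiset" "'p fm multiset" (infix "\<Rrightarrow>" 50)

text \<open>A linear nested sequent is the nonempty list of its components, from left to right. A possibly
  empty prefix is an arbitrary list; derivable lists are nonempty because every conclusion is.\<close>

type_synonym 'p lns = "'p component list"

inductive LNS_KB :: "'p lns \<Rightarrow> bool" where
  init: "LNS_KB (G @ [add_mset (Atom p) \<Gamma> \<Rrightarrow> add_mset (Atom p) \<Delta>])"
| BotL: "LNS_KB (G @ [add_mset \<^bold>\<bottom> \<Gamma> \<Rrightarrow> \<Delta>])"
| EW: "G \<noteq> [] \<Longrightarrow> LNS_KB G \<Longrightarrow> LNS_KB (G @ [\<Gamma> \<Rrightarrow> \<Delta>])"
| ImpR: "LNS_KB (G @ [add_mset A \<Gamma> \<Rrightarrow> add_mset B (add_mset (A \<^bold>\<rightarrow> B) \<Delta>)]) \<Longrightarrow>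
    LNS_KB (G @ [\<Gamma> \<Rrightarrow> add_mset (A \<^bold>\<rightarrow> B) \<Delta>])"
| ImpL: "LNS_KB (G @ [add_mset B (add_mset (A \<^bold>\<rightarrow> B) \<Gamma>) \<Rrightarrow> \<Delta>]) \<Longrightarrow>
    LNS_KB (G @ [add_mset (A \<^bold>\<rightarrow> B) \<Gamma> \<Rrightarrow> add_mset A \<Delta>]) \<Longrightarrow>
    LNS_KB (G @ [add_mset (A \<^bold>\<rightarrow> B) \<Gamma> \<Rrightarrow> \<Delta>])"
| BoxR: "LNS_KB (G @ [\<Gamma> \<Rrightarrow> add_mset (\<^bold>\<box> A) \<Delta>, {#} \<Rrightarrow> {#A#}]) \<Longrightarrow>
    LNS_KB (G @ [\<Gamma> \<Rrightarrow> add_mset (\<^bold>\<box> A) \<Delta>])"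
| BoxL1: "LNS_KB (G @ [add_mset (\<^bold>\<box> A) \<Gamma> \<Rrightarrow> \<Delta>, add_mset A \<Sigma> \<Rrightarrow> \<Pi>]) \<Longrightarrow>
    LNS_KB (G @ [add_mset (\<^bold>\<box> A) \<Gamma> \<Rrightarrow> \<Delta>, \<Sigma> \<Rrightarrow> \<Pi>])"
| BoxL2: "LNS_KB (G @ [add_mset A \<Gamma> \<Rrightarrow> \<Delta>]) \<Longrightarrow>
    LNS_KB (G @ [\<Gamma> \<Rrightarrow> \<Delta>, add_mset (\<^bold>\<box> A) \<Sigma> \<Rrightarrow> \<Pi>])"

end

theory Submission
  imports Defs "HOL-Library.Countable_Set"
begin

text \<open>
  Soundness: no derivable sequent can be refuted along a path of a symmetric model.

  Completeness: call a component maximal after a prefix if the sequent is underivable but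
  becomes derivable as soon as a new subformula of \<open>\<phi>\<close> is added on either side. The worlds of the
  countermodel are the nonempty sequents each of whose components is maximal after its predecessors;
  two of them are adjacent if one extends the other by one component. The rule \<open>\<box>\<^sub>L\<^sup>1\<close> gives the truth
  lemma for boxes towards extensions. Towards the prefix it is given by \<open>\<box>\<^sub>L\<^sup>2\<close>: as this rule discards
  the last component, it applies to the prefix, whose last component was chosen maximal.
  There are only countably many worlds, so they embed into any infinite type.
\<close>

section \<open>Soundness\<close>

fun falsifies :: "('w \<times> 'w) set \<Rightarrow> ('p \<Rightarrow> 'w set) \<Rightarrow> 'w \<Rightarrow> 'p component \<Rightarrow> bool" where
  "falsifies R V w (\<Gamma> \<Rrightarrow> \<Delta>) \<longleftrightarrow>
     (\<forall>A\<in>#\<Gamma>. forces R V w A) \<and> (\<forall>A\<in>#\<Delta>. \<not> forces R V w A)"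

text \<open>The components are listed from right to left, and \<open>w\<close> is the last world of the path.\<close>

fun refutes_rev :: "('w \<times> 'w) set \<Rightarrow> ('p \<Rightarrow> 'w set) \<Rightarrow> 'w \<Rightarrow> 'p lns \<Rightarrow> bool" where
  "refutes_rev R V w [] \<longleftrightarrow> True"
| "refutes_rev R V w (C # S) \<longleftrightarrow>
     falsifies R V w C \<and> (S = [] \<or> (\<exists>v. (v, w) \<in> R \<and> refutes_rev R V v S))"

text \<open>Every rule hands a refuting path from its conclusion to a premise. The last world varies
  in the induction: \<open>EW\<close> and \<open>BoxL2\<close> drop it, and \<open>BoxR\<close>
  appends a successor that refutes the unboxed formula. Symmetry enters at \<open>BoxL2\<close>,
  where the last world must see its predecessor.\<close>

lemma LNS_KB_not_refuted:
  assumes "LNS_KB S" and "sym R"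
  shows "\<not> refutes_rev R V w (rev S)"
  using assms(1)
proof (induction arbitrary: w)
  case (BoxL2 G A \<Gamma> \<Delta> \<Sigma> \<Pi>)
  then show ?case using assms(2) by (auto dest: symD)
qed auto

corollary soundness:
  assumes "LNS_KB [{#} \<Rrightarrow> {#\<phi>#}]"
  shows "\<phi> \<in> KB TYPE('w)"
  using LNS_KB_not_refuted[OF assms] unfolding KB_def by fastforce

section \<open>The canonical model\<close>

primrec subfms :: "'p fm \<Rightarrow> 'p fm set" where
  "subfms (Atom p) = {Atom p}"
| "subfms \<^bold>\<bottom> = {\<^bold>\<bottom>}"
| "subfms (A \<^bold>\<rightarrow> B) = insert (A \<^bold>\<rightarrow> B) (subfms A \<union> subfms B)"
| "subfms (\<^bold>\<box> A) = insert (\<^bold>\<box> A) (subfms A)"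

lemma finite_subfms: "finite (subfms A)"
  by (induction A) auto

lemma subfms_refl: "A \<in> subfms A"
  by (cases A) auto

lemma subfms_Imp: "A \<^bold>\<rightarrow> B \<in> subfms C \<Longrightarrow> A \<in> subfms C \<and> B \<in> subfms C"
  by (induction C) (auto simp: subfms_refl)

lemma subfms_Box: "\<^bold>\<box> A \<in> subfms C \<Longrightarrow> A \<in> subfms C"
  by (induction C) (auto simp: subfms_refl)

fun ante succ :: "'p component \<Rightarrow> 'p fm multiset" where
  "ante (\<Gamma> \<Rrightarrow> \<Delta>) = \<Gamma>"
| "succ (\<Gamma> \<Rrightarrow> \<Delta>) = \<Delta>"

text \<open>Only the underlying sets are maximal, not the multisets: \<open>ImpR\<close> adds both of its formulas
  even if one of them is present already.\<close>

definition maximal :: "'p fm set \<Rightarrow> 'p lns \<Rightarrow> 'p component \<Rightarrow> bool" where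
  "maximal F G C \<longleftrightarrow> set_mset (ante C) \<subseteq> F \<and> set_mset (succ C) \<subseteq> F \<and> \<not> LNS_KB (G @ [C]) \<and>
     (\<forall>\<Gamma> \<Delta>. ante C \<subseteq># \<Gamma> \<and> succ C \<subseteq># \<Delta> \<and> set_mset \<Gamma> \<subseteq> F \<and> set_mset \<Delta> \<subseteq> F \<and>
        \<not> LNS_KB (G @ [\<Gamma> \<Rrightarrow> \<Delta>]) \<longrightarrow> set_mset \<Gamma> = set_mset (ante C) \<and> set_mset \<Delta> = set_mset (succ C))"

text \<open>Multiplicities can grow without bound, but the distinct formulas, counted on each side,
  number at most twice the size of \<open>F\<close>. An underivable extension with the largest count
  therefore exists, and it is maximal.\<close>

lemma maximal_extension:
  assumes "finite F" "set_mset \<Gamma> \<subseteq> F" "set_mset \<Delta> \<subseteq> F" "\<not> LNS_KB (G @ [\<Gamma> \<Rrightarrow> \<Delta>])"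
  shows "\<exists>C. maximal F G C \<and> \<Gamma> \<subseteq># ante C \<and> \<Delta> \<subseteq># succ C"
proof -
  let ?P = "\<lambda>C. \<Gamma> \<subseteq># ante C \<and> \<Delta> \<subseteq># succ C \<and> set_mset (ante C) \<subseteq> F \<and> set_mset (succ C) \<subseteq> F \<and>
    \<not> LNS_KB (G @ [C])"
  let ?m = "\<lambda>C. card (set_mset (ante C)) + card (set_mset (succ C))"
  have "?P (\<Gamma> \<Rrightarrow> \<Delta>)" using assms by simp
  moreover have "\<forall>C. ?P C \<longrightarrow> ?m C < Suc (card F + card F)"
    using assms(1) by (auto simp: less_Suc_eq_le intro!: add_mono card_mono)
  ultimately obtain C where C: "?P C" and max: "\<forall>D. ?P D \<longrightarrow> ?m D \<le> ?m C"
    using ex_has_greatest_nat[of ?P _ ?m] by blast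
  have "set_mset \<Gamma>' = set_mset (ante C) \<and> set_mset \<Delta>' = set_mset (succ C)"
    if D: "ante C \<subseteq># \<Gamma>'" "succ C \<subseteq># \<Delta>'" "set_mset \<Gamma>' \<subseteq> F" "set_mset \<Delta>' \<subseteq> F"
      "\<not> LNS_KB (G @ [\<Gamma>' \<Rrightarrow> \<Delta>'])" for \<Gamma>' \<Delta>'
  proof -
    have "?P (\<Gamma>' \<Rrightarrow> \<Delta>')" using C D by (auto intro: subset_mset.order_trans)
    then have le: "card (set_mset \<Gamma>') + card (set_mset \<Delta>') \<le> ?m C" using max by fastforce
    have sub: "set_mset (ante C) \<subseteq> set_mset \<Gamma>'" "set_mset (succ C) \<subseteq> set_mset \<Delta>'"
      using D by (auto dest: mset_subset_eqD)
    then have "card (set_mset (ante C)) \<le> card (set_mset \<Gamma>')"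
      "card (set_mset (succ C)) \<le> card (set_mset \<Delta>')"
      by (auto intro: card_mono)
    with le have "card (set_mset (ante C)) = card (set_mset \<Gamma>')"
      "card (set_mset (succ C)) = card (set_mset \<Delta>')" by linarith+
    with sub show ?thesis by (metis card_subset_eq finite_set_mset)
  qed
  with C show ?thesis unfolding maximal_def by blast
qed

text \<open>This is how maximality meets the rules: an underivable conclusion has an underivable
  premise, so the formulas which that premise adds are already present.\<close>

lemma maximal_closed:
  assumes "maximal F G (\<Gamma> \<Rrightarrow> \<Delta>)" "set_mset \<Gamma>' \<subseteq> F" "set_mset \<Delta>' \<subseteq> F"
    "\<not> LNS_KB (G @ [\<Gamma>' + \<Gamma> \<Rrightarrow> \<Delta>' + \<Delta>])"
  shows "set_mset \<Gamma>' \<subseteq> set_mset \<Gamma> \<and> set_mset \<Delta>' \<subseteq> set_mset \<Delta>"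
proof -
  have "set_mset (\<Gamma>' + \<Gamma>) = set_mset \<Gamma> \<and> set_mset (\<Delta>' + \<Delta>) = set_mset \<Delta>"
    using assms unfolding maximal_def by (metis (no_types, lifting) ante.simps succ.simps
      mset_subset_eq_add_right set_mset_union Un_subset_iff)
  then show ?thesis by auto
qed

inductive canonical :: "'p fm set \<Rightarrow> 'p lns \<Rightarrow> bool" for F where
  Nil: "canonical F []"
| snoc: "canonical F G \<Longrightarrow> maximal F G C \<Longrightarrow> canonical F (G @ [C])"

lemma canonical_snocD: "canonical F (G @ [C]) \<Longrightarrow> canonical F G \<and> maximal F G C"
  by (auto elim: canonical.cases)

text \<open>The empty list only starts the construction: it has no last component from which truth
  could be read off.\<close>

definition worlds :: "'p fm set \<Rightarrow> 'p lns set" where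
  "worlds F = {S. canonical F S \<and> S \<noteq> []}"

definition adjacent :: "'p fm set \<Rightarrow> ('p lns \<times> 'p lns) set" where
  "adjacent F = {(S, T) \<in> worlds F \<times> worlds F. \<exists>C. T = S @ [C] \<or> S = T @ [C]}"

definition valuation :: "'p fm set \<Rightarrow> 'p \<Rightarrow> 'p lns set" where
  "valuation F p = {S \<in> worlds F. Atom p \<in># ante (last S)}"

lemma worlds_cases:
  assumes "S \<in> worlds F"
  obtains G \<Gamma> \<Delta> where "S = G @ [\<Gamma> \<Rrightarrow> \<Delta>]" "maximal F G (\<Gamma> \<Rrightarrow> \<Delta>)" "canonical F G"
proof -
  have "canonical F S" "S \<noteq> []" using assms by (auto simp: worlds_def)
  then obtain G C where "S = G @ [C]" "maximal F G C" "canonical F G"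
    by (auto elim: canonical.cases)
  then show thesis using that by (cases C) auto
qed

text \<open>Two implications take the place of an equivalence: the calculus has no cut rule, and
  nothing here forces a formula of \<open>F\<close> onto one of the two sides. \<open>S\<close> is
  arbitrary because the box case moves to adjacent worlds.\<close>

lemma truth_lemma:
  assumes "\<And>A B. A \<^bold>\<rightarrow> B \<in> F \<Longrightarrow> A \<in> F \<and> B \<in> F" and "\<And>A. \<^bold>\<box> A \<in> F \<Longrightarrow> A \<in> F" and "finite F"
    and "S \<in> worlds F"
  shows "(A \<in># ante (last S) \<longrightarrow> forces (adjacent F) (valuation F) S A) \<and>
    (A \<in># succ (last S) \<longrightarrow> \<not> forces (adjacent F) (valuation F) S A)"
  using assms(4)
proof (induction A arbitrary: S)
  case (Atom p)
  then obtain G \<Gamma> \<Delta> where S: "S = G @ [\<Gamma> \<Rrightarrow> \<Delta>]" and max: "maximal F G (\<Gamma> \<Rrightarrow> \<Delta>)"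
    by (auto elim: worlds_cases)
  \<comment> \<open>One copy of the principal formula is split off to match the
    \<open>add_mset\<close> of the rule; the other rules are instantiated in the same way.\<close>
  have "Atom p \<notin># \<Delta>" if "Atom p \<in># \<Gamma>"
    using that max LNS_KB.init[of G p "\<Gamma> - {#Atom p#}" "\<Delta> - {#Atom p#}"] unfolding maximal_def by auto
  then show ?case using Atom S by (auto simp: valuation_def)
next
  case Bot
  then obtain G \<Gamma> \<Delta> where S: "S = G @ [\<Gamma> \<Rrightarrow> \<Delta>]" and max: "maximal F G (\<Gamma> \<Rrightarrow> \<Delta>)"
    by (auto elim: worlds_cases)
  have "\<^bold>\<bottom> \<notin># \<Gamma>"
    using max LNS_KB.BotL[of G "\<Gamma> - {#\<^bold>\<bottom>#}" \<Delta>] unfolding maximal_def by auto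
  then show ?case using S by simp
next
  case (Imp A B)
  then obtain G \<Gamma> \<Delta> where S: "S = G @ [\<Gamma> \<Rrightarrow> \<Delta>]" and max: "maximal F G (\<Gamma> \<Rrightarrow> \<Delta>)"
    by (auto elim: worlds_cases)
  have nd: "\<not> LNS_KB (G @ [\<Gamma> \<Rrightarrow> \<Delta>])" and F: "set_mset \<Gamma> \<subseteq> F" "set_mset \<Delta> \<subseteq> F"
    using max unfolding maximal_def by auto
  have L: "B \<in># \<Gamma> \<or> A \<in># \<Delta>" if "A \<^bold>\<rightarrow> B \<in># \<Gamma>"
  proof -
    have "\<not> LNS_KB (G @ [add_mset B \<Gamma> \<Rrightarrow> \<Delta>]) \<or> \<not> LNS_KB (G @ [\<Gamma> \<Rrightarrow> add_mset A \<Delta>])"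
      using nd LNS_KB.ImpL[of G B A "\<Gamma> - {#A \<^bold>\<rightarrow> B#}" \<Delta>] that by auto
    moreover have "A \<in> F \<and> B \<in> F" using that F assms(1) by blast
    ultimately show ?thesis
      using maximal_closed[OF max, of "{#B#}" "{#}"] maximal_closed[OF max, of "{#}" "{#A#}"] by auto
  qed
  have R: "A \<in># \<Gamma> \<and> B \<in># \<Delta>" if "A \<^bold>\<rightarrow> B \<in># \<Delta>"
  proof -
    have "\<not> LNS_KB (G @ [add_mset A \<Gamma> \<Rrightarrow> add_mset B \<Delta>])"
      using nd LNS_KB.ImpR[of G A \<Gamma> B "\<Delta> - {#A \<^bold>\<rightarrow> B#}"] that by auto
    moreover have "A \<in> F \<and> B \<in> F" using that F assms(1) by blast
    ultimately show ?thesis using maximal_closed[OF max, of "{#A#}" "{#B#}"] by auto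
  qed
  show ?case using L R Imp.IH(1)[OF Imp.prems] Imp.IH(2)[OF Imp.prems] S by auto
next
  case (Box A)
  then obtain G \<Gamma> \<Delta> where S: "S = G @ [\<Gamma> \<Rrightarrow> \<Delta>]" and max: "maximal F G (\<Gamma> \<Rrightarrow> \<Delta>)"
    by (auto elim: worlds_cases)
  have S': "canonical F S" using Box.prems by (simp add: worlds_def)
  have nd: "\<not> LNS_KB S" and F: "set_mset \<Gamma> \<subseteq> F" "set_mset \<Delta> \<subseteq> F"
    using max S unfolding maximal_def by auto
  have L: "A \<in># ante (last T)" if box: "\<^bold>\<box> A \<in># \<Gamma>" and adj: "(S, T) \<in> adjacent F" for T
  proof -
    have "A \<in> F" using box F assms(2) by blast
    obtain C where C: "T = S @ [C] \<or> S = T @ [C]" and T: "canonical F T" "T \<noteq> []"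
      using adj unfolding adjacent_def worlds_def by auto
    from C show ?thesis
    proof
      assume T': "T = S @ [C]"
      obtain \<Sigma> \<Pi> where C': "C = (\<Sigma> \<Rrightarrow> \<Pi>)" by (cases C)
      have m: "maximal F S (\<Sigma> \<Rrightarrow> \<Pi>)" using T canonical_snocD C' T' by blast
      then have "\<not> LNS_KB (G @ [\<Gamma> \<Rrightarrow> \<Delta>, \<Sigma> \<Rrightarrow> \<Pi>])" using S unfolding maximal_def by auto
      then have "\<not> LNS_KB (G @ [\<Gamma> \<Rrightarrow> \<Delta>, add_mset A \<Sigma> \<Rrightarrow> \<Pi>])"
        using LNS_KB.BoxL1[of G A "\<Gamma> - {#\<^bold>\<box> A#}" \<Delta> \<Sigma> \<Pi>] box by auto
      then show ?thesis
        using maximal_closed[OF m, of "{#A#}" "{#}"] \<open>A \<in> F\<close> S T' C' by auto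
    next
      assume "S = T @ [C]"
      then have "T = G" using S by simp
      \<comment> \<open>As a world, \<open>T\<close> is nonempty, so it has a last component to
        receive \<open>A\<close> when \<open>BoxL2\<close> removes the last component of
        \<open>S\<close>.\<close>
      obtain H \<Sigma> \<Pi> where H: "T = H @ [\<Sigma> \<Rrightarrow> \<Pi>]" and m: "maximal F H (\<Sigma> \<Rrightarrow> \<Pi>)"
        using adj by (auto simp: adjacent_def elim: worlds_cases)
      have "\<not> LNS_KB (H @ [add_mset A \<Sigma> \<Rrightarrow> \<Pi>])"
        using nd S H \<open>T = G\<close> LNS_KB.BoxL2[of H A \<Sigma> \<Pi> "\<Gamma> - {#\<^bold>\<box> A#}" \<Delta>] box by auto
      then show ?thesis
        using maximal_closed[OF m, of "{#A#}" "{#}"] \<open>A \<in> F\<close> H by auto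
    qed
  qed
  have R: "\<exists>T. (S, T) \<in> adjacent F \<and> A \<in># succ (last T)" if box: "\<^bold>\<box> A \<in># \<Delta>"
  proof -
    have "A \<in> F" using box F assms(2) by blast
    \<comment> \<open>The premise of \<open>BoxR\<close> supplies the seed of the refuting
      successor; a maximal extension of the new component turns it into a world.\<close>
    have "\<not> LNS_KB (S @ [{#} \<Rrightarrow> {#A#}])"
      using nd S box LNS_KB.BoxR[of G \<Gamma> A "\<Delta> - {#\<^bold>\<box> A#}"] by auto
    then obtain C where C: "maximal F S C" "{#A#} \<subseteq># succ C"
      using maximal_extension[OF assms(3), of "{#}" "{#A#}" S] \<open>A \<in> F\<close> by auto
    then have "(S, S @ [C]) \<in> adjacent F"
      using S' Box.prems by (auto simp: adjacent_def worlds_def intro: canonical.snoc)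
    then show ?thesis using C by fastforce
  qed
  have IH: "(A \<in># ante (last T) \<longrightarrow> forces (adjacent F) (valuation F) T A) \<and>
    (A \<in># succ (last T) \<longrightarrow> \<not> forces (adjacent F) (valuation F) T A)" if "(S, T) \<in> adjacent F" for T
    using Box.IH that unfolding adjacent_def by blast
  show ?case using L R IH S by fastforce
qed

section \<open>Completeness\<close>

text \<open>A world is a finite list of pairs of finite multisets over the finite set
  \<open>F\<close>, and each multiset is the image of a list.\<close>

lemma countable_worlds:
  assumes "finite F"
  shows "countable (worlds F)"
proof -
  let ?C = "(\<lambda>(xs, ys). mset xs \<Rrightarrow> mset ys) ` (lists F \<times> lists F)"
  have C: "C \<in> ?C" if "maximal F G C" for G C
  proof -
    obtain xs ys where "mset xs = ante C" "mset ys = succ C" using ex_mset by metis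
    moreover from this have "set xs \<subseteq> F" "set ys \<subseteq> F"
      using that unfolding maximal_def by (metis set_mset_mset)+
    ultimately show ?thesis by (cases C) (force simp: image_iff)
  qed
  have "S \<in> lists ?C" if "canonical F S" for S
    using that by induction (use C in auto)
  moreover have "countable (lists ?C)"
    using assms by (intro countable_lists countable_image countable_SIGMA)
      (auto simp: countable_finite)
  ultimately show ?thesis
    unfolding worlds_def by (auto intro: countable_subset)
qed

text \<open>Forcing is invariant under isomorphism. Since \<open>f\<close> is injective only on
  \<open>W\<close>, the relation and the valuation have to stay inside \<open>W\<close>.\<close>

lemma forces_inj_image:
  assumes "inj_on f W" "R \<subseteq> W \<times> W" "\<And>p. V p \<subseteq> W" "w \<in> W"
  shows "forces (map_prod f f ` R) (\<lambda>p. f ` V p) (f w) A \<longleftrightarrow> forces R V w A"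
  using assms(4)
proof (induction A arbitrary: w)
  case (Atom p)
  then show ?case using assms(1,3) by (simp add: inj_on_image_mem_iff)
next
  case (Box A)
  \<comment> \<open>Injectivity identifies every preimage of \<open>f w\<close> in \<open>W\<close>
    with \<open>w\<close>, so the image relation adds no successors.\<close>
  have "(f w, y) \<in> map_prod f f ` R \<longleftrightarrow> (\<exists>v. y = f v \<and> (w, v) \<in> R)" for y
  proof
    assume "(f w, y) \<in> map_prod f f ` R"
    then obtain u v where "(u, v) \<in> R" "f w = f u" "y = f v" by auto
    moreover from this have "w = u" using inj_onD[OF assms(1)] assms(2) Box.prems by blast
    ultimately show "\<exists>v. y = f v \<and> (w, v) \<in> R" by blast
  qed auto
  then have "forces (map_prod f f ` R) (\<lambda>p. f ` V p) (f w) (\<^bold>\<box> A) \<longleftrightarrow>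
      (\<forall>v. (w, v) \<in> R \<longrightarrow> forces (map_prod f f ` R) (\<lambda>p. f ` V p) (f v) A)"
    by auto
  moreover have "v \<in> W" if "(w, v) \<in> R" for v using that assms(2) by blast
  ultimately show ?case using Box.IH by auto
qed auto

lemma countable_inj_on_infinite:
  assumes "countable A" "infinite (UNIV :: 'w set)"
  obtains f :: "'a \<Rightarrow> 'w" where "inj_on f A"
proof -
  obtain g :: "nat \<Rightarrow> 'w" where "inj g"
    using infinite_countable_subset[OF assms(2)] by blast
  then have "inj_on (g \<circ> to_nat_on A) A"
    using assms(1) by (intro comp_inj_on inj_on_to_nat_on) (auto intro: inj_on_subset)
  then show thesis using that by blast
qed

text \<open>The worlds of the canonical countermodel are sequents, whereas the hypothesis speaks of
  models over another type. Being infinite, that type has room for a copy of the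
  countermodel.\<close>

lemma completeness:
  fixes \<phi> :: "'p fm"
  assumes inf: "infinite (UNIV :: 'w set)" and "\<phi> \<in> KB TYPE('w)"
  shows "LNS_KB [{#} \<Rrightarrow> {#\<phi>#}]"
proof (rule ccontr)
  assume nd: "\<not> LNS_KB [{#} \<Rrightarrow> {#\<phi>#}]"
  let ?F = "subfms \<phi>"
  \<comment> \<open>The refuting world has a single component: the goal sequent, made maximal after
    the empty prefix.\<close>
  obtain C where C: "maximal ?F [] C" "{#\<phi>#} \<subseteq># succ C"
    using maximal_extension[OF finite_subfms, of "{#}" \<phi> "{#\<phi>#}" "[]"] nd subfms_refl by auto
  then have w: "[C] \<in> worlds ?F"
    using canonical.snoc[OF canonical.Nil, of ?F C] by (simp add: worlds_def)
  then have refuted: "\<not> forces (adjacent ?F) (valuation ?F) [C] \<phi>"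
    using truth_lemma[OF subfms_Imp subfms_Box finite_subfms w] C by simp
  obtain f :: "'p lns \<Rightarrow> 'w" where f: "inj_on f (worlds ?F)"
    using countable_inj_on_infinite[OF countable_worlds[OF finite_subfms] inf] .
  have sub: "adjacent ?F \<subseteq> worlds ?F \<times> worlds ?F" "\<And>p. valuation ?F p \<subseteq> worlds ?F"
    by (auto simp: adjacent_def valuation_def)
  let ?R = "map_prod f f ` adjacent ?F" and ?V = "\<lambda>p. f ` valuation ?F p"
  have "kripke_model (f ` worlds ?F) ?R ?V"
    using sub w unfolding kripke_model_def by auto
  moreover have "sym (adjacent ?F)"
    by (auto simp: adjacent_def sym_def)
  then have "sym ?R"
    by (auto intro!: symI dest: symD)
  ultimately have "forces ?R ?V (f [C]) \<phi>"
    using assms(2) w unfolding KB_def by blast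
  then show False using refuted forces_inj_image[OF f sub(1) _ w, of "valuation ?F"] sub(2) by simp
qed

theorem theorem22:
  fixes \<phi> :: "'p fm"
  assumes "infinite (UNIV :: 'w set)"
  shows "LNS_KB [{#} \<Rrightarrow> {#\<phi>#}] \<longleftrightarrow> \<phi> \<in> KB TYPE('w)"
  using soundness completeness[OF assms] by blast

end
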